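(* Let $G$ be a finite simple graph with vertex set $[n]$, and let $\Delta_G$ be its coloring complex. Then $\Delta_G$ is isomorphic, as a simplicial complex, to the restriction of the simplicial cell decomposition $A_{K_n}\cap S^{n-2}$ to the arrangement $A_G$, i.e. to the subcomplex of $A_{K_n}\cap S^{n-2}$ consisting of those cells contained in the union of the hyperplanes of $A_G$.
   Context: The coloring complex $\Delta_G$ of a graph $G$ on vertex set $V(G)=[n]$ is the simplicial complex whose $(r-1)$-dimensional faces are the ordered lists $T_1|T_2|\cdots|T_r$ of nonempty pairwise disjoint subsets of $V(G)$ such that $\bigcup_{i} T_i \neq V(G)$ and at least one $T_i$ contains both endpoints of some edge of $G$; face inclusion is refinement of such ordered lists (equivalently, $\Delta_G$ is a subcomplex of the order complex of the proper part of the Boolean lattice, a face $T_1|\cdots|T_r$ corresponding to the chain $T_1\subset T_1\cup T_2\subset\cdots\subset T_1\cup\cdots\cup T_r$). For a graph $G$ on $[n]$, $A_G$ is the real hyperplane arrangement in $\mathbb{R}^n$ consisting of the hyperplanes $x_i=x_j$ for each edge $\{i,j\}\in E(G)$; $A_{K_n}$ is the braid arrangement (all hyperplanes $x_i=x_j$, $i<j$). Let $H=\{a\in\mathbb{R}^n:\sum a_i=0\}$ and $S^{n-2}$ the unit sphere of $H$. The hyperplanes of $A_{K_n}$ cut $S^{n-2}$ into a simplicial cell decomposition, denoted $A_{K_n}\cap S^{n-2}$, whose cells correspond to ordered set partitions $S_1|\cdots|S_r$ ($r\ge 2$) of $[n]$: a point $a$ lies in the cell where $S_1$ is the set of coordinates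 attaining the minimum value, $S_2$ the set attaining the minimum among the remaining coordinates, and so on.
   Formalization: In the coloring complex, the edge may also lie in the unlisted nonempty block V(G) minus the union of the T_i; if only the listed T_i count, the claim fails (n=3, single edge 12: one face against two cells). The empty face is left out on both sides. *)

theory Defs
  imports "HOL-Analysis.Analysis"
begin

text \<open>The vertex set \<open>[n]\<close> is the universe of a finite type \<open>'n\<close>, so that \<open>n = CARD('n)\<close>;
  a graph is given by its set of edges.\<close>

definition simple_graph :: "'n::finite set set \<Rightarrow> bool" where
  "simple_graph E \<longleftrightarrow> (\<forall>e\<in>E. card e = 2)"

definition complete_graph :: "'n::finite set set" where
  "complete_graph = {e. card e = 2}"

text \<open>Simplicial complexes consist of nonempty faces only: the empty face is left out everywhere.
  The vertex set of \<open>K\<close> is \<open>\<Union>K\<close>.\<close>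

definition simplicial_complex :: "'a set set \<Rightarrow> bool" where
  "simplicial_complex K \<longleftrightarrow>
     (\<forall>F\<in>K. finite F \<and> F \<noteq> {} \<and> (\<forall>F'. F' \<subseteq> F \<and> F' \<noteq> {} \<longrightarrow> F' \<in> K))"

definition simplicial_isomorphic :: "'a set set \<Rightarrow> 'b set set \<Rightarrow> bool" where
  "simplicial_isomorphic K L \<longleftrightarrow>
     (\<exists>f. bij_betw f (\<Union>K) (\<Union>L) \<and> (`) f ` K = L)"

text \<open>The ordered lists \<open>T\<^sub>1|\<dots>|T\<^sub>r\<close> with \<open>r \<ge> 1\<close>. The edge may also lie in the last, unwritten block
  \<open>- (T\<^sub>1 \<union> \<dots> \<union> T\<^sub>r)\<close>, which is nonempty. Without this block the lists would not be closed under
  passing to subchains: if only \<open>T\<^sub>r\<close> contains an edge, that edge lies in the unwritten block of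
  the face \<open>T\<^sub>1|\<dots>|T\<^bsub>r-1\<^esub>\<close>.\<close>

definition coloring_lists :: "'n::finite set set \<Rightarrow> 'n set list set" where
  "coloring_lists E =
     {Ts. Ts \<noteq> [] \<and> (\<forall>T\<in>set Ts. T \<noteq> {}) \<and> sorted_wrt disjnt Ts \<and> \<Union>(set Ts) \<noteq> UNIV \<and>
          (\<exists>T\<in>set (Ts @ [- \<Union>(set Ts)]). \<exists>e\<in>E. e \<subseteq> T)}"

definition chain_of_list :: "'n set list \<Rightarrow> 'n set set" where
  "chain_of_list Ts = {\<Union>(set (take i Ts)) | i. 1 \<le> i \<and> i \<le> length Ts}"

text \<open>Refinement of ordered lists is inclusion of the corresponding chains.\<close>

definition coloring_complex :: "'n::finite set set \<Rightarrow> 'n set set set" where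
  "coloring_complex E = chain_of_list ` coloring_lists E"

text \<open>In an arrangement the pair \<open>(a, b)\<close> stands for the hyperplane \<open>a \<bullet> x = b\<close>.\<close>

definition graphic_arrangement :: "'n::finite set set \<Rightarrow> ((real^'n) \<times> real) set" where
  "graphic_arrangement E = {(axis i 1 - axis j 1, 0) | i j. {i, j} \<in> E}"

definition arrangement_union :: "('a::real_inner \<times> real) set \<Rightarrow> 'a set" where
  "arrangement_union A = (\<Union>(a, b)\<in>A. {x. a \<bullet> x = b})"

text \<open>The relatively open face of the arrangement containing \<open>x\<close>: all points on the same side of,
  or on, every hyperplane as \<open>x\<close> is.\<close>

definition arrangement_cell :: "('a::real_inner \<times> real) set \<Rightarrow> 'a \<Rightarrow> 'a set" where
  "arrangement_cell A x = {y. \<forall>(a, b)\<in>A. sgn (a \<bullet> y - b) = sgn (a \<bullet> x - b)}"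

definition sum_zero_sphere :: "(real^'n::finite) set" where
  "sum_zero_sphere = {a. (\<Sum>i\<in>UNIV. a $ i) = 0} \<inter> sphere 0 1"

definition braid_cells :: "(real^'n::finite) set set" where
  "braid_cells =
     {arrangement_cell (graphic_arrangement complete_graph) x \<inter> sum_zero_sphere | x.
        x \<in> sum_zero_sphere}"

definition restricted_cells :: "'n::finite set set \<Rightarrow> (real^'n) set set" where
  "restricted_cells E = {C \<in> braid_cells. C \<subseteq> arrangement_union (graphic_arrangement E)}"

definition cell_vertices :: "'a::topological_space set set \<Rightarrow> 'a set \<Rightarrow> 'a set" where
  "cell_vertices \<C> C = {v. {v} \<in> \<C> \<and> v \<in> closure C}"

definition vertex_scheme :: "'a::topological_space set set \<Rightarrow> 'a set set" where
  "vertex_scheme \<C> = cell_vertices \<C> ` \<C>"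

text \<open>A family of open cells is simplicial if it is faithfully encoded by its vertex scheme: cells
  are determined by their vertices and the face relation (a cell lies in the closure of another)
  becomes inclusion of vertex sets.\<close>

definition simplicial_cells :: "'a::topological_space set set \<Rightarrow> bool" where
  "simplicial_cells \<C> \<longleftrightarrow>
     simplicial_complex (vertex_scheme \<C>) \<and> inj_on (cell_vertices \<C>) \<C> \<and>
     (\<forall>C\<in>\<C>. \<forall>D\<in>\<C>. C \<subseteq> closure D \<longleftrightarrow> cell_vertices \<C> C \<subseteq> cell_vertices \<C> D)"

end

theory Submission
  imports Defs
begin

text \<open>A point \<open>x\<close> of the sphere is encoded by the chain of its proper nonempty sublevel sets. Two
  points lie in the same cell iff their chains agree, and moving from \<open>y\<close> to \<open>y + t *\<^sub>R x\<close> shows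
  that the closure of a cell consists of the points whose chain is contained in that of the cell.
  Every chain occurs, a one-element chain \<open>{S}\<close> occurs at exactly one point, and \<open>x\<close> lies on
  the hyperplane of an edge iff no sublevel set of \<open>x\<close> separates its endpoints. Hence the
  vertices of a cell are the points of the one-element subchains of its chain, and the chains of the
  cells inside the graphic arrangement are exactly the faces of the coloring complex.\<close>

section \<open>Chains of sublevel sets\<close>

text \<open>For the ordered set partition S_1|...|S_r given by the levels of x, these are the
  partial unions S_1, S_1 \<union> S_2, ... short of the full set. Comparing S with its complement
  avoids thresholds.\<close>

definition sublevel_chain :: "real^'n::finite \<Rightarrow> 'n set set" where
  "sublevel_chain x = {S. S \<noteq> {} \<and> S \<noteq> UNIV \<and> (\<forall>i\<in>S. \<forall>j\<in>-S. x $ i < x $ j)}"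

definition proper_chains :: "'n::finite set set set" where
  "proper_chains = {c. c \<noteq> {} \<and> {} \<notin> c \<and> UNIV \<notin> c \<and> subset.chain UNIV c}"

text \<open>An edge that no member cuts lies within one block of the ordered set partition, where
  the last block is the complement of the largest member.\<close>

definition edge_chains :: "'n::finite set set \<Rightarrow> 'n set set set" where
  "edge_chains E = {c \<in> proper_chains. \<exists>e\<in>E. \<forall>S\<in>c. e \<subseteq> S \<or> e \<inter> S = {}}"

text \<open>The chain determines the weak order of the coordinates: if x_i > x_j, the sublevel set
  at height x_j is a member that contains j but not i.\<close>

lemma le_iff_sublevel_chain:
  "x $ i \<le> x $ j \<longleftrightarrow> (\<forall>S\<in>sublevel_chain x. j \<in> S \<longrightarrow> i \<in> S)"
proof
  assume "x $ i \<le> x $ j"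
  then show "\<forall>S\<in>sublevel_chain x. j \<in> S \<longrightarrow> i \<in> S"
    by (auto simp: sublevel_chain_def Ball_def not_less[symmetric])
next
  assume *: "\<forall>S\<in>sublevel_chain x. j \<in> S \<longrightarrow> i \<in> S"
  show "x $ i \<le> x $ j"
  proof (rule ccontr)
    assume "\<not> x $ i \<le> x $ j"
    then have "{k. x $ k \<le> x $ j} \<in> sublevel_chain x"
      by (auto simp: sublevel_chain_def)
    with * \<open>\<not> x $ i \<le> x $ j\<close> show False by fastforce
  qed
qed

text \<open>Losing members of the chain means merging adjacent levels without reversing any. For
  fixed x the right-hand side is a closed condition on y, as closures of cells require.\<close>

lemma sublevel_chain_subset_iff:
  "sublevel_chain y \<subseteq> sublevel_chain x \<longleftrightarrow> (\<forall>i j. x $ i \<le> x $ j \<longrightarrow> y $ i \<le> y $ j)"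
proof
  assume "sublevel_chain y \<subseteq> sublevel_chain x"
  then show "\<forall>i j. x $ i \<le> x $ j \<longrightarrow> y $ i \<le> y $ j"
    unfolding le_iff_sublevel_chain by blast
next
  assume *: "\<forall>i j. x $ i \<le> x $ j \<longrightarrow> y $ i \<le> y $ j"
  show "sublevel_chain y \<subseteq> sublevel_chain x"
    unfolding sublevel_chain_def using * by (fastforce simp flip: not_le)
qed

lemma sublevel_chain_eq_iff:
  "sublevel_chain y = sublevel_chain x \<longleftrightarrow> (\<forall>i j. x $ i \<le> x $ j \<longleftrightarrow> y $ i \<le> y $ j)"
  using sublevel_chain_subset_iff[of y x] sublevel_chain_subset_iff[of x y] by blast

lemma sublevel_chain_scaleR:
  "t > 0 \<Longrightarrow> sublevel_chain (t *\<^sub>R x) = sublevel_chain x"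
  by (simp add: sublevel_chain_def)

lemma sublevel_chain_sgn:
  "x \<noteq> 0 \<Longrightarrow> sublevel_chain (sgn x) = sublevel_chain x"
  by (simp add: sgn_div_norm sublevel_chain_scaleR)

lemma subset_chain_sublevel_chain: "subset.chain UNIV (sublevel_chain x)"
proof -
  have "S \<subseteq> T \<or> T \<subseteq> S" if "S \<in> sublevel_chain x" "T \<in> sublevel_chain x" for S T
  proof (rule ccontr)
    assume "\<not> ?thesis"
    then obtain i j where "i \<in> S" "i \<notin> T" "j \<in> T" "j \<notin> S" by blast
    then have "x $ i < x $ j" "x $ j < x $ i"
      using that by (auto simp: sublevel_chain_def)
    then show False by simp
  qed
  then show ?thesis by (simp add: subset_chain_def)
qed

lemma sublevel_chain_empty_iff:
  "sublevel_chain x = {} \<longleftrightarrow> (\<forall>i j. x $ i = x $ j)"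
proof
  assume "sublevel_chain x = {}"
  then have "x $ i \<le> x $ j" for i j by (simp add: le_iff_sublevel_chain)
  then show "\<forall>i j. x $ i = x $ j" by (simp add: order_antisym)
next
  assume eq: "\<forall>i j. x $ i = x $ j"
  have False if "S \<in> sublevel_chain x" for S
  proof -
    have "S \<noteq> {}" "S \<noteq> UNIV" using that by (simp_all add: sublevel_chain_def)
    then obtain i j where "i \<in> S" "j \<in> - S" by blast
    then have "x $ i < x $ j" using that by (simp add: sublevel_chain_def)
    then show False using eq by (metis less_irrefl)
  qed
  then show "sublevel_chain x = {}" by blast
qed

lemma sublevel_chain_nonempty:
  assumes "x \<in> sum_zero_sphere"
  shows "sublevel_chain x \<noteq> {}"
proof
  assume "sublevel_chain x = {}"
  then have c: "x $ i = x $ j" for i j by (simp add: sublevel_chain_empty_iff)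
  have "x $ j = 0" for j
  proof -
    have "(\<Sum>i\<in>UNIV. x $ i) = (\<Sum>i\<in>(UNIV::'a set). x $ j)"
      by (rule sum.cong[OF refl c])
    then show ?thesis using assms by (simp add: sum_zero_sphere_def)
  qed
  then have "x = 0" by (simp add: vec_eq_iff)
  then show False using assms by (simp add: sum_zero_sphere_def)
qed

lemma sublevel_chain_in_proper_chains:
  "x \<in> sum_zero_sphere \<Longrightarrow> sublevel_chain x \<in> proper_chains"
  using sublevel_chain_nonempty[of x] subset_chain_sublevel_chain[of x]
  by (auto simp: proper_chains_def sublevel_chain_def)

section \<open>Points with a prescribed chain\<close>

text \<open>The block sizes serve as weights so that the coordinates sum to zero, with the lower
  value on S.\<close>

definition two_level :: "'n::finite set \<Rightarrow> real^'n" where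
  "two_level S = (\<chi> i. if i \<in> S then - real (card (- S)) else real (card S))"

lemma two_level_nth:
  "two_level S $ i = (if i \<in> S then - real (card (- S)) else real (card S))"
  by (simp add: two_level_def)

lemma sum_over_two_blocks:
  fixes S :: "'n::finite set"
  shows "(\<Sum>i\<in>UNIV. if i \<in> S then a else b) = real (card S) * a + real (card (- S)) * b"
proof -
  have "{i. i \<notin> S} = - S" by auto
  then show ?thesis by (simp add: sum.If_cases)
qed

lemma sum_two_level: "(\<Sum>i\<in>UNIV. two_level S $ i) = 0"
  by (simp add: two_level_nth sum_over_two_blocks)

lemma two_level_le_iff:
  assumes "S \<noteq> {}" "S \<noteq> UNIV"
  shows "two_level S $ i \<le> two_level S $ j \<longleftrightarrow> (j \<in> S \<longrightarrow> i \<in> S)"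
proof -
  have "card S > 0" "card (- S) > 0"
    using assms by (auto simp: card_gt_0_iff)
  then show ?thesis by (auto simp: two_level_nth)
qed

text \<open>The two inclusions use the chain property differently: it makes the summands
  \<open>two_level S\<close> comonotone, and it puts finite unions and intersections of members back into
  the chain.\<close>

lemma sublevel_chain_sum_two_level:
  assumes "c \<in> proper_chains"
  shows "sublevel_chain (\<Sum>S\<in>c. two_level S) = c" (is "sublevel_chain ?w = c")
proof -
  have fin: "finite c" by simp
  have proper: "S \<noteq> {}" "S \<noteq> UNIV" if "S \<in> c" for S
    using assms that by (auto simp: proper_chains_def)
  have chain: "S \<subseteq> T \<or> T \<subseteq> S" if "S \<in> c" "T \<in> c" for S T
    using assms that by (auto simp: proper_chains_def subset_chain_def)
  have closed: "\<Union>A \<in> c" "\<Inter>A \<in> c" if "A \<subseteq> c" "A \<noteq> {}" for A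
  proof -
    have "finite A" "subset.chain UNIV A"
      using that chain by (auto simp: subset_chain_def)
    then show "\<Union>A \<in> c" "\<Inter>A \<in> c"
      using that Union_in_chain Inter_in_chain by blast+
  qed
  have w: "?w $ i = (\<Sum>S\<in>c. two_level S $ i)" for i by simp
  have less: "?w $ i < ?w $ j" if "T \<in> c" "i \<in> T" "j \<notin> T" for i j T
    unfolding w
  proof (rule sum_strict_mono_ex1[OF fin])
    show "\<forall>S\<in>c. two_level S $ i \<le> two_level S $ j"
      using chain that proper by (auto simp: two_level_le_iff)
    show "\<exists>S\<in>c. two_level S $ i < two_level S $ j"
      using that proper by (auto simp: two_level_le_iff simp flip: not_le)
  qed
  have separated: "\<exists>T\<in>c. i \<in> T \<and> j \<notin> T" if "?w $ i < ?w $ j" for i j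
  proof (rule ccontr)
    assume "\<not> ?thesis"
    then have "?w $ j \<le> ?w $ i"
      unfolding w using proper by (intro sum_mono) (auto simp: two_level_le_iff)
    then show False using that by simp
  qed
  show ?thesis
  proof
    show "c \<subseteq> sublevel_chain ?w"
    proof
      fix S assume "S \<in> c"
      then show "S \<in> sublevel_chain ?w"
        using less[of S] proper[of S] by (simp add: sublevel_chain_def del: sum_component)
    qed
    show "sublevel_chain ?w \<subseteq> c"
    proof
      fix S assume S: "S \<in> sublevel_chain ?w"
      \<comment> \<open>For fixed i the members separating i from the various j outside S intersect
        in a set that contains i and stays within S. The union of these sets over i is therefore
        S.\<close>
      have "\<forall>i\<in>S. \<forall>j\<in>-S. \<exists>T\<in>c. i \<in> T \<and> j \<notin> T"
        using S separated by (simp add: sublevel_chain_def del: sum_component)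
      then obtain T where T: "\<And>i j. i \<in> S \<Longrightarrow> j \<in> - S \<Longrightarrow> T i j \<in> c \<and> i \<in> T i j \<and> j \<notin> T i j"
        by metis
      have ne: "S \<noteq> {}" "- S \<noteq> {}"
        using S by (auto simp: sublevel_chain_def)
      have "\<Inter>(T i ` (- S)) \<in> c" if "i \<in> S" for i
        using T that ne by (intro closed) auto
      then have "\<Union>((\<lambda>i. \<Inter>(T i ` (- S))) ` S) \<in> c"
        using ne by (intro closed) auto
      also have "\<Union>((\<lambda>i. \<Inter>(T i ` (- S))) ` S) = S"
        using T by blast
      finally show "S \<in> c" .
    qed
  qed
qed

lemma sgn_in_sum_zero_sphere:
  assumes "(\<Sum>i\<in>UNIV. x $ i) = 0" "x \<noteq> 0"
  shows "sgn x \<in> sum_zero_sphere"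
  using assms by (simp add: sum_zero_sphere_def sgn_div_norm flip: sum_distrib_left)

lemma ex_point_with_sublevel_chain:
  assumes "c \<in> proper_chains"
  shows "\<exists>x\<in>sum_zero_sphere. sublevel_chain x = c"
proof -
  let ?w = "\<Sum>S\<in>c. two_level S"
  have "sublevel_chain ?w \<noteq> {}"
    using assms by (simp add: sublevel_chain_sum_two_level) (simp add: proper_chains_def)
  then have "?w \<noteq> 0"
    by (metis sublevel_chain_empty_iff zero_index)
  moreover have "(\<Sum>i\<in>UNIV. ?w $ i) = 0"
    by (simp add: sum.swap[of _ c] sum_two_level)
  ultimately show ?thesis
    using assms sgn_in_sum_zero_sphere[of ?w] sublevel_chain_sgn[of ?w]
    by (metis sublevel_chain_sum_two_level)
qed

definition vertex_point :: "'n::finite set \<Rightarrow> real^'n" where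
  "vertex_point S = sgn (two_level S)"

lemma singleton_in_proper_chains:
  "S \<noteq> {} \<Longrightarrow> S \<noteq> UNIV \<Longrightarrow> {S} \<in> proper_chains"
  by (auto simp: proper_chains_def subset_chain_def)

lemma vertex_point:
  assumes "S \<noteq> {}" "S \<noteq> UNIV"
  shows "vertex_point S \<in> sum_zero_sphere" "sublevel_chain (vertex_point S) = {S}"
proof -
  have *: "sublevel_chain (two_level S) = {S}"
    using sublevel_chain_sum_two_level[OF singleton_in_proper_chains[OF assms]] by simp
  then have "two_level S \<noteq> 0"
    by (metis sublevel_chain_empty_iff zero_index insert_not_empty)
  then show "vertex_point S \<in> sum_zero_sphere" "sublevel_chain (vertex_point S) = {S}"
    by (simp_all add: vertex_point_def sgn_in_sum_zero_sphere sum_two_level sublevel_chain_sgn *)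
qed

text \<open>A vector with chain {S} is constant on S and on its complement. The zero sum fixes the
  ratio of the two values, and the unit norm together with the lower value on S fixes the
  scale.\<close>

lemma eq_vertex_point:
  assumes "v \<in> sum_zero_sphere" "sublevel_chain v = {S}"
  shows "v = vertex_point S"
proof -
  have "S \<in> sublevel_chain v" using assms by simp
  then have S: "S \<noteq> {}" "S \<noteq> UNIV" and less: "\<And>i j. i \<in> S \<Longrightarrow> j \<notin> S \<Longrightarrow> v $ i < v $ j"
    by (auto simp: sublevel_chain_def)
  then obtain k l where kl: "k \<in> S" "l \<notin> S" by blast
  have le: "v $ i \<le> v $ j \<longleftrightarrow> (j \<in> S \<longrightarrow> i \<in> S)" for i j
    using assms(2) by (simp add: le_iff_sublevel_chain)
  have nth: "v $ i = (if i \<in> S then v $ k else v $ l)" for i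
    using kl le by (auto intro: order_antisym)
  have pos: "real (card S) > 0" "real (card (- S)) > 0"
    using S by (auto simp: card_gt_0_iff)
  have "(\<Sum>i\<in>UNIV. v $ i) = real (card S) * v $ k + real (card (- S)) * v $ l"
    by (subst nth) (rule sum_over_two_blocks)
  then have sum0: "real (card S) * v $ k + real (card (- S)) * v $ l = 0"
    using assms(1) by (simp add: sum_zero_sphere_def)
  \<comment> \<open>The factor between v and \<open>two_level S\<close>, read off outside S; the
    zero sum forces the same factor on S.\<close>
  define s where "s = v $ l / real (card S)"
  have "v $ l = s * real (card S)" "v $ k = - s * real (card (- S))"
  proof -
    show "v $ l = s * real (card S)" using S by (simp add: s_def)
    then have "real (card S) * (v $ k + s * real (card (- S))) = 0"
      using sum0 by (simp add: algebra_simps)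
    then have "v $ k + s * real (card (- S)) = 0" using S by simp
    then show "v $ k = - s * real (card (- S))" by simp
  qed
  then have v: "v = s *\<^sub>R two_level S"
    by (subst vec_eq_iff) (subst nth, auto simp: two_level_nth)
  have "v $ l > 0"
  proof (rule ccontr)
    assume "\<not> v $ l > 0"
    then have "v $ k < 0" "v $ l \<le> 0" using less[OF kl] by auto
    then have "real (card S) * v $ k < 0" "real (card (- S)) * v $ l \<le> 0"
      using pos by (simp_all add: mult_pos_neg mult_nonneg_nonpos)
    then show False using sum0 by linarith
  qed
  then have "s > 0" using pos by (simp add: s_def)
  have "v = sgn v"
    using assms(1) by (simp add: sum_zero_sphere_def sgn_div_norm)
  also have "\<dots> = vertex_point S"
    using \<open>s > 0\<close> by (simp add: v sgn_scaleR vertex_point_def)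
  finally show ?thesis .
qed

section \<open>Cells of the braid arrangement\<close>

definition chain_cell :: "'n::finite set set \<Rightarrow> (real^'n) set" where
  "chain_cell c = {y \<in> sum_zero_sphere. sublevel_chain y = c}"

text \<open>The signs of all differences of coordinates and the chain both record precisely the weak
  order of the coordinates.\<close>

lemma braid_cell_eq_chain_cell:
  "arrangement_cell (graphic_arrangement complete_graph) x \<inter> sum_zero_sphere =
     chain_cell (sublevel_chain x)"
proof -
  have "y \<in> arrangement_cell (graphic_arrangement complete_graph) x \<longleftrightarrow>
    (\<forall>i j. i \<noteq> j \<longrightarrow> sgn (y $ i - y $ j) = sgn (x $ i - x $ j))" for y
  proof -
    have "card {i, j} = 2 \<longleftrightarrow> i \<noteq> j" for i j :: 'a by (simp add: card_insert_if)
    then have "y \<in> arrangement_cell (graphic_arrangement complete_graph) x \<longleftrightarrow>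
      (\<forall>i j. i \<noteq> j \<longrightarrow> sgn ((axis i 1 - axis j 1) \<bullet> y) = sgn ((axis i 1 - axis j 1) \<bullet> x))"
      unfolding arrangement_cell_def graphic_arrangement_def complete_graph_def by fastforce
    then show ?thesis by (simp add: inner_diff_left inner_axis')
  qed
  moreover have "(\<forall>i j. i \<noteq> j \<longrightarrow> sgn (y $ i - y $ j) = sgn (x $ i - x $ j)) \<longleftrightarrow>
    (\<forall>i j. x $ i \<le> x $ j \<longleftrightarrow> y $ i \<le> y $ j)" for y
  proof
    assume *: "\<forall>i j. i \<noteq> j \<longrightarrow> sgn (y $ i - y $ j) = sgn (x $ i - x $ j)"
    show "\<forall>i j. x $ i \<le> x $ j \<longleftrightarrow> y $ i \<le> y $ j"
    proof (intro allI)
      fix i j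
      show "x $ i \<le> x $ j \<longleftrightarrow> y $ i \<le> y $ j"
        using *[rule_format, of i j] by (cases "i = j") (auto simp: sgn_real_def split: if_splits)
    qed
  next
    assume *: "\<forall>i j. x $ i \<le> x $ j \<longleftrightarrow> y $ i \<le> y $ j"
    show "\<forall>i j. i \<noteq> j \<longrightarrow> sgn (y $ i - y $ j) = sgn (x $ i - x $ j)"
    proof (intro allI impI)
      fix i j
      show "sgn (y $ i - y $ j) = sgn (x $ i - x $ j)"
        using *[rule_format, of i j] *[rule_format, of j i] by (auto simp: sgn_real_def)
    qed
  qed
  ultimately show ?thesis
    by (auto simp: chain_cell_def sublevel_chain_eq_iff)
qed

lemma sublevel_chain_image: "sublevel_chain ` sum_zero_sphere = proper_chains"
proof
  show "sublevel_chain ` sum_zero_sphere \<subseteq> proper_chains"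
    by (rule image_subsetI) (rule sublevel_chain_in_proper_chains)
  show "proper_chains \<subseteq> sublevel_chain ` sum_zero_sphere"
  proof
    fix c assume "c \<in> proper_chains"
    from ex_point_with_sublevel_chain[OF this] show "c \<in> sublevel_chain ` sum_zero_sphere" by blast
  qed
qed

lemma braid_cells_eq: "braid_cells = chain_cell ` proper_chains"
  unfolding braid_cells_def braid_cell_eq_chain_cell sublevel_chain_image[symmetric]
  by (simp add: Setcompr_eq_image image_image)

lemma chain_cell_nonempty: "c \<in> proper_chains \<Longrightarrow> chain_cell c \<noteq> {}"
  using ex_point_with_sublevel_chain[of c] by (auto simp: chain_cell_def)

text \<open>In the limit strict inequalities between coordinates may become equalities, so sublevel
  sets can be lost but never gained.\<close>

lemma closure_chain_cell:
  assumes "c \<in> proper_chains"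
  shows "closure (chain_cell c) = {y \<in> sum_zero_sphere. sublevel_chain y \<subseteq> c}"
proof -
  obtain x where x: "x \<in> sum_zero_sphere" and c: "sublevel_chain x = c"
    using ex_point_with_sublevel_chain[OF assms] by blast
  \<comment> \<open>Written with weak inequalities, the set is visibly closed.\<close>
  have eq: "{y \<in> sum_zero_sphere. sublevel_chain y \<subseteq> c} =
      {y. (\<Sum>i\<in>UNIV. y $ i) = 0} \<inter> sphere 0 1 \<inter>
      (\<Inter>i. \<Inter>j\<in>{j. x $ i \<le> x $ j}. {y. y $ i \<le> y $ j})"
    unfolding c[symmetric] sublevel_chain_subset_iff sum_zero_sphere_def by auto
  have "closed {y \<in> sum_zero_sphere. sublevel_chain y \<subseteq> c}"
    unfolding eq
    by (intro closed_Int closed_INT ballI closed_Collect_eq closed_Collect_le closed_sphere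
        continuous_intros)
  moreover have "chain_cell c \<subseteq> {y \<in> sum_zero_sphere. sublevel_chain y \<subseteq> c}"
    by (auto simp: chain_cell_def)
  ultimately have "closure (chain_cell c) \<subseteq> {y \<in> sum_zero_sphere. sublevel_chain y \<subseteq> c}"
    by (rule closure_minimal[rotated])
  moreover have "y \<in> closure (chain_cell c)"
    if y: "y \<in> sum_zero_sphere" and sub: "sublevel_chain y \<subseteq> c" for y
  proof -
    have mono: "y $ i \<le> y $ j" if "x $ i \<le> x $ j" for i j
      using that sub unfolding c[symmetric] sublevel_chain_subset_iff by blast
    \<comment> \<open>As y is weakly monotone in the order of x, adding a positive multiple of x
      breaks the ties of y as x does and reverses nothing. This works for every t > 0, not only for
      small t.\<close>
    have in_cell: "sgn (y + t *\<^sub>R x) \<in> chain_cell c" if "t > 0" for t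
    proof -
      have "x $ i \<le> x $ j \<longleftrightarrow> (y + t *\<^sub>R x) $ i \<le> (y + t *\<^sub>R x) $ j" for i j
      proof (cases "x $ i \<le> x $ j")
        case True
        then show ?thesis using mono[OF True] that by (simp add: add_mono)
      next
        case False
        then have "y $ j \<le> y $ i" "t * x $ j < t * x $ i" using mono[of j i] that by auto
        then show ?thesis using False by simp
      qed
      then have *: "sublevel_chain (y + t *\<^sub>R x) = c"
        unfolding c[symmetric] sublevel_chain_eq_iff by blast
      then have "y + t *\<^sub>R x \<noteq> 0"
        using sublevel_chain_nonempty[OF x] c by (metis sublevel_chain_empty_iff zero_index)
      moreover have "(\<Sum>i\<in>UNIV. (y + t *\<^sub>R x) $ i) = 0"
        using x y by (simp add: sum_zero_sphere_def sum.distrib flip: sum_distrib_left)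
      ultimately show ?thesis
        using * by (simp add: chain_cell_def sublevel_chain_sgn sgn_in_sum_zero_sphere)
    qed
    \<comment> \<open>Normalization is continuous at y because y has norm 1, so these points of the
      cell converge to y.\<close>
    have "((\<lambda>t. sgn (y + t *\<^sub>R x)) \<longlongrightarrow> sgn (y + 0 *\<^sub>R x)) (at_right 0)"
      using y by (intro tendsto_intros) (auto simp: sum_zero_sphere_def)
    moreover have "sgn (y + 0 *\<^sub>R x) = y"
      using y by (simp add: sum_zero_sphere_def sgn_div_norm)
    moreover have "\<forall>\<^sub>F t in at_right 0. sgn (y + t *\<^sub>R x) \<in> closure (chain_cell c)"
      using in_cell closure_subset by (auto intro: eventually_mono[OF eventually_at_right_less])
    ultimately show ?thesis
      using Lim_in_closed_set[OF closed_closure _ trivial_limit_at_right_real] by fastforce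
  qed
  ultimately show ?thesis by blast
qed

text \<open>Each S in c puts \<open>vertex_point S\<close> into the closure of the cell. A one-point
  cell is closed, so its point is that vertex and c can only be {S}.\<close>

lemma chain_cell_eq_singleton_iff:
  assumes "c \<in> proper_chains"
  shows "chain_cell c = {v} \<longleftrightarrow> (\<exists>S. c = {S} \<and> v = vertex_point S)"
proof
  assume v: "chain_cell c = {v}"
  have singleton: "sublevel_chain v = {S} \<and> v = vertex_point S" if "S \<in> c" for S
  proof -
    have S: "S \<noteq> {}" "S \<noteq> UNIV" using that assms by (auto simp: proper_chains_def)
    then have "vertex_point S \<in> closure (chain_cell c)"
      using vertex_point[OF S] that by (simp add: closure_chain_cell[OF assms])
    then have "vertex_point S = v" using v by simp
    then show ?thesis using vertex_point(2)[OF S] by simp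
  qed
  obtain S where "S \<in> c" using assms by (auto simp: proper_chains_def)
  moreover have "sublevel_chain v = c" using v by (auto simp: chain_cell_def)
  ultimately show "\<exists>S. c = {S} \<and> v = vertex_point S" using singleton[of S] by auto
next
  assume "\<exists>S. c = {S} \<and> v = vertex_point S"
  then obtain S where S: "c = {S}" "v = vertex_point S" by blast
  moreover have "S \<noteq> {}" "S \<noteq> UNIV" using assms S by (auto simp: proper_chains_def)
  ultimately show "chain_cell c = {v}"
    using vertex_point[of S] eq_vertex_point[of _ S] unfolding chain_cell_def by blast
qed

section \<open>Cells inside the graphic arrangement\<close>

lemma mem_arrangement_union_iff:
  assumes "simple_graph E"
  shows "x \<in> arrangement_union (graphic_arrangement E) \<longleftrightarrow>
    (\<exists>e\<in>E. \<forall>S\<in>sublevel_chain x. e \<subseteq> S \<or> e \<inter> S = {})"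
proof -
  have eq_iff: "x $ i = x $ j \<longleftrightarrow> (\<forall>S\<in>sublevel_chain x. {i, j} \<subseteq> S \<or> {i, j} \<inter> S = {})" for i j
  proof -
    have "x $ i = x $ j \<longleftrightarrow> x $ i \<le> x $ j \<and> x $ j \<le> x $ i" by auto
    then show ?thesis
      unfolding le_iff_sublevel_chain ball_conj_distrib[symmetric]
      by (simp only:) (intro ball_cong refl, auto)
  qed
  have "x \<in> arrangement_union (graphic_arrangement E) \<longleftrightarrow> (\<exists>i j. {i, j} \<in> E \<and> x $ i = x $ j)"
    by (auto simp: arrangement_union_def graphic_arrangement_def inner_diff_left inner_axis')
  also have "\<dots> \<longleftrightarrow> (\<exists>e\<in>E. \<forall>S\<in>sublevel_chain x. e \<subseteq> S \<or> e \<inter> S = {})"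
  proof -
    have "\<exists>i j. e = {i, j}" if "e \<in> E" for e
      using assms that unfolding simple_graph_def card_2_iff by metis
    then show ?thesis unfolding eq_iff by metis
  qed
  finally show ?thesis .
qed

text \<open>Whether a point lies on a hyperplane of the arrangement depends only on its chain. A
  cell is thus either inside the union or disjoint from it, and since cells are nonempty one point
  decides which.\<close>

lemma restricted_cells_eq:
  assumes "simple_graph E"
  shows "restricted_cells E = chain_cell ` edge_chains E"
proof -
  have "chain_cell c \<subseteq> arrangement_union (graphic_arrangement E) \<longleftrightarrow> c \<in> edge_chains E"
    if c: "c \<in> proper_chains" for c
  proof -
    have "x \<in> arrangement_union (graphic_arrangement E) \<longleftrightarrow> c \<in> edge_chains E"
      if "x \<in> chain_cell c" for x
      using that c mem_arrangement_union_iff[OF assms, of x]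
      by (simp add: edge_chains_def chain_cell_def)
    then show ?thesis using chain_cell_nonempty[OF c] by blast
  qed
  moreover have "edge_chains E \<subseteq> proper_chains" by (auto simp: edge_chains_def)
  ultimately show ?thesis unfolding restricted_cells_def braid_cells_eq by blast
qed

text \<open>Dropping members merges blocks, so an edge within one block stays within one
  block.\<close>

lemma edge_chains_subset:
  assumes "c \<in> edge_chains E" "d \<subseteq> c" "d \<noteq> {}"
  shows "d \<in> edge_chains E"
proof -
  obtain e where "e \<in> E" "\<forall>S\<in>c. e \<subseteq> S \<or> e \<inter> S = {}" and c: "c \<in> proper_chains"
    using assms(1) by (auto simp: edge_chains_def)
  then have "\<exists>e\<in>E. \<forall>S\<in>d. e \<subseteq> S \<or> e \<inter> S = {}" using assms(2) by blast
  moreover have "d \<in> proper_chains"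
    using c assms(2,3) unfolding proper_chains_def subset_chain_def mem_Collect_eq
    by (meson subset_iff subset_UNIV)
  ultimately show ?thesis by (simp add: edge_chains_def)
qed

text \<open>Only points that are cells of the restricted family count as vertices. None is lost by
  this, since every one-element subchain of c is again an edge chain.\<close>

lemma cell_vertices_restricted_cells:
  assumes "simple_graph E" "c \<in> edge_chains E"
  shows "cell_vertices (restricted_cells E) (chain_cell c) = vertex_point ` c"
proof -
  have c: "c \<in> proper_chains" using assms by (simp add: edge_chains_def)
  have "chain_cell d = {v} \<longleftrightarrow> (\<exists>S. d = {S} \<and> v = vertex_point S)" if "d \<in> edge_chains E" for d v
    using that chain_cell_eq_singleton_iff[of d v] by (simp add: edge_chains_def)
  then have vertex: "{v} \<in> chain_cell ` edge_chains E \<longleftrightarrow>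
      (\<exists>S. {S} \<in> edge_chains E \<and> v = vertex_point S)" for v
    unfolding image_iff by metis
  have "vertex_point S \<in> closure (chain_cell c) \<longleftrightarrow> S \<in> c" if "{S} \<in> edge_chains E" for S
  proof -
    have S: "S \<noteq> {}" "S \<noteq> UNIV" using that by (auto simp: edge_chains_def proper_chains_def)
    show ?thesis using vertex_point[OF S] by (simp add: closure_chain_cell[OF c])
  qed
  moreover have "{S} \<in> edge_chains E" if "S \<in> c" for S
    using edge_chains_subset[OF assms(2)] that by simp
  ultimately show ?thesis
    unfolding cell_vertices_def restricted_cells_eq[OF assms(1)] vertex by blast
qed

section \<open>The vertex scheme as a complex of chains\<close>

lemma vertex_scheme_restricted_cells:
  assumes "simple_graph E"
  shows "vertex_scheme (restricted_cells E) = (`) vertex_point ` edge_chains E"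
proof -
  have "vertex_scheme (restricted_cells E) =
      (\<lambda>c. cell_vertices (restricted_cells E) (chain_cell c)) ` edge_chains E"
    unfolding vertex_scheme_def by (subst (2) restricted_cells_eq[OF assms]) (simp add: image_image)
  then show ?thesis using cell_vertices_restricted_cells[OF assms] by simp
qed

lemma inj_on_vertex_point: "inj_on vertex_point (\<Union>(edge_chains E))"
proof (rule inj_on_inverseI)
  fix S assume "S \<in> \<Union>(edge_chains E)"
  then have "S \<noteq> {}" "S \<noteq> UNIV" by (auto simp: edge_chains_def proper_chains_def)
  \<comment> \<open>Taking the only member of the chain is a left inverse of
    \<open>vertex_point\<close>.\<close>
  then show "the_elem (sublevel_chain (vertex_point S)) = S" by (simp add: vertex_point)
qed

lemma vertex_point_image_subset_iff:
  assumes "c \<in> edge_chains E" "d \<in> edge_chains E"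
  shows "vertex_point ` c \<subseteq> vertex_point ` d \<longleftrightarrow> c \<subseteq> d"
  using inj_on_image_subset_iff[OF inj_on_vertex_point[of E]] assms by (simp add: Union_upper)

lemma simplicial_cells_restricted_cells:
  assumes "simple_graph E"
  shows "simplicial_cells (restricted_cells E)"
  unfolding simplicial_cells_def
proof (intro conjI)
  show "simplicial_complex (vertex_scheme (restricted_cells E))"
    unfolding simplicial_complex_def vertex_scheme_restricted_cells[OF assms]
  proof (intro ballI conjI allI impI)
    fix F assume "F \<in> (`) vertex_point ` edge_chains E"
    then obtain c where c: "c \<in> edge_chains E" "F = vertex_point ` c" by blast
    then show "finite F" "F \<noteq> {}" by (auto simp: edge_chains_def proper_chains_def)
    fix F' assume "F' \<subseteq> F \<and> F' \<noteq> {}"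
    then obtain d where "d \<subseteq> c" "F' = vertex_point ` d" "d \<noteq> {}"
      using c by (metis subset_imageE image_is_empty)
    then show "F' \<in> (`) vertex_point ` edge_chains E"
      using edge_chains_subset[OF c(1)] by blast
  qed
  show "inj_on (cell_vertices (restricted_cells E)) (restricted_cells E)"
  proof (rule inj_onI)
    fix C D
    assume "C \<in> restricted_cells E" "D \<in> restricted_cells E" and
      eq: "cell_vertices (restricted_cells E) C = cell_vertices (restricted_cells E) D"
    then obtain c d where "c \<in> edge_chains E" "C = chain_cell c" "d \<in> edge_chains E" "D = chain_cell d"
      by (auto simp: restricted_cells_eq[OF assms])
    then show "C = D"
      using eq vertex_point_image_subset_iff[of c E d] vertex_point_image_subset_iff[of d E c]
      by (simp add: cell_vertices_restricted_cells[OF assms])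
  qed
  show "\<forall>C\<in>restricted_cells E. \<forall>D\<in>restricted_cells E. C \<subseteq> closure D \<longleftrightarrow>
      cell_vertices (restricted_cells E) C \<subseteq> cell_vertices (restricted_cells E) D"
  proof (intro ballI)
    fix C D assume "C \<in> restricted_cells E" "D \<in> restricted_cells E"
    then obtain c d where cd: "c \<in> edge_chains E" "C = chain_cell c" "d \<in> edge_chains E" "D = chain_cell d"
      by (auto simp: restricted_cells_eq[OF assms])
    then have "c \<in> proper_chains" "d \<in> proper_chains" by (auto simp: edge_chains_def)
    then have "C \<noteq> {}" "closure D = {y \<in> sum_zero_sphere. sublevel_chain y \<subseteq> d}"
      using cd by (simp_all add: chain_cell_nonempty closure_chain_cell)
    moreover have "y \<in> sum_zero_sphere \<and> sublevel_chain y = c" if "y \<in> C" for y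
      using that cd by (simp add: chain_cell_def)
    \<comment> \<open>All points of C have chain c, and C is nonempty, so a single point settles the
      inclusion.\<close>
    ultimately have "C \<subseteq> closure D \<longleftrightarrow> c \<subseteq> d" by blast
    then show "C \<subseteq> closure D \<longleftrightarrow>
        cell_vertices (restricted_cells E) C \<subseteq> cell_vertices (restricted_cells E) D"
      using cd by (simp add: cell_vertices_restricted_cells[OF assms] vertex_point_image_subset_iff)
  qed
qed

section \<open>Faces of the coloring complex\<close>

lemma chain_of_list_Nil: "chain_of_list [] = {}"
  by (auto simp: chain_of_list_def)

text \<open>Appending a block keeps the earlier partial unions and adds one on top; hence the
  inductions from the right end below.\<close>

lemma chain_of_list_snoc:
  "chain_of_list (Ts @ [T]) = insert (\<Union>(set Ts) \<union> T) (chain_of_list Ts)"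
proof -
  have "{i. 1 \<le> i \<and> i \<le> length (Ts @ [T])} = insert (Suc (length Ts)) {i. 1 \<le> i \<and> i \<le> length Ts}"
    by auto
  moreover have "chain_of_list Us = (\<lambda>i. \<Union>(set (take i Us))) ` {i. 1 \<le> i \<and> i \<le> length Us}"
    for Us :: "'a set list"
    by (auto simp: chain_of_list_def)
  ultimately show ?thesis by (auto simp: Un_commute)
qed

lemma Union_chain_of_list: "\<Union>(chain_of_list Ts) = \<Union>(set Ts)"
  by (induction Ts rule: rev_induct) (auto simp: chain_of_list_Nil chain_of_list_snoc)

lemma chain_of_list_empty_iff: "chain_of_list Ts = {} \<longleftrightarrow> Ts = []"
  by (cases Ts rule: rev_cases) (auto simp: chain_of_list_Nil chain_of_list_snoc)

lemma Union_set_in_chain_of_list: "Ts \<noteq> [] \<Longrightarrow> \<Union>(set Ts) \<in> chain_of_list Ts"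
  by (cases Ts rule: rev_cases) (auto simp: chain_of_list_snoc Un_commute)

lemma subset_chain_chain_of_list: "subset.chain UNIV (chain_of_list Ts)"
proof (induction Ts rule: rev_induct)
  case Nil
  then show ?case by (simp add: chain_of_list_Nil subset_chain_def)
next
  case (snoc T Ts)
  then show ?case
    using Union_chain_of_list[of Ts] by (fastforce simp: chain_of_list_snoc subset_chain_def)
qed

lemma empty_notin_chain_of_list:
  "\<forall>T\<in>set Ts. T \<noteq> {} \<Longrightarrow> {} \<notin> chain_of_list Ts"
  by (induction Ts rule: rev_induct) (auto simp: chain_of_list_Nil chain_of_list_snoc)

text \<open>The listed blocks and the unwritten last one are the pieces into which the partial
  unions cut the vertex set. In the induction a new block T splits off from the unwritten
  one.\<close>

lemma unseparated_by_chain_of_list_iff: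
  assumes "sorted_wrt disjnt Ts" "e \<noteq> {}"
  shows "(\<forall>S\<in>chain_of_list Ts. e \<subseteq> S \<or> e \<inter> S = {}) \<longleftrightarrow>
    (\<exists>T\<in>set (Ts @ [- \<Union>(set Ts)]). e \<subseteq> T)"
  using assms(1)
proof (induction Ts rule: rev_induct)
  case Nil
  then show ?case by (simp add: chain_of_list_Nil)
next
  case (snoc T Ts)
  have "sorted_wrt disjnt Ts" and disj: "\<Union>(set Ts) \<inter> T = {}"
    using snoc.prems by (simp_all add: sorted_wrt_append) (auto simp: disjnt_def)
  then have IH: "(\<forall>S\<in>chain_of_list Ts. e \<subseteq> S \<or> e \<inter> S = {}) \<longleftrightarrow>
      (\<exists>T\<in>set Ts. e \<subseteq> T) \<or> e \<subseteq> - \<Union>(set Ts)"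
    using snoc.IH by auto
  \<comment> \<open>If e lies in an earlier block, the new partial union contains it. If e avoids
    all earlier blocks, the new union meets e only in T, so e must lie in T or in the new
    remainder.\<close>
  have "(\<exists>T\<in>set Ts. e \<subseteq> T) \<Longrightarrow> e \<subseteq> \<Union>(set Ts)" by blast
  then show ?case
    using disj assms(2) unfolding chain_of_list_snoc ball_simps IH by auto
qed

text \<open>Blocks are the successive differences of the chain: take the list of the chain without
  its top member and append what the top adds.\<close>

lemma ex_list_with_chain:
  assumes "finite c" "subset.chain UNIV c" "{} \<notin> c"
  shows "\<exists>Ts. (\<forall>T\<in>set Ts. T \<noteq> {}) \<and> sorted_wrt disjnt Ts \<and> chain_of_list Ts = c"
  using assms
proof (induction c rule: finite_psubset_induct)
  case (psubset c)
  show ?case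
  proof (cases "c = {}")
    case True
    then show ?thesis by (intro exI[of _ "[]"]) (simp add: chain_of_list_Nil)
  next
    case False
    define d where "d = c - {\<Union>c}"
    have top: "\<Union>c \<in> c" using Union_in_chain psubset.hyps False psubset.prems by blast
    have chain: "subset.chain UNIV d" using psubset.prems by (auto simp: d_def subset_chain_def)
    have "\<exists>Ts. (\<forall>T\<in>set Ts. T \<noteq> {}) \<and> sorted_wrt disjnt Ts \<and> chain_of_list Ts = d"
      using top psubset.prems chain by (intro psubset.IH) (auto simp: d_def)
    then obtain Ts where Ts: "\<forall>T\<in>set Ts. T \<noteq> {}" "sorted_wrt disjnt Ts" "chain_of_list Ts = d"
      by blast
    have Un: "\<Union>(set Ts) = \<Union>d" using Ts Union_chain_of_list by metis
    \<comment> \<open>The appended block must be nonempty. If members remain, their union is one of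
      them and differs from the top; if none remain, the top is nonempty because {} is not in
      c.\<close>
    have "\<Union>d \<noteq> \<Union>c"
    proof (cases "d = {}")
      case True
      then show ?thesis using top psubset.prems by (metis Union_empty)
    next
      case False
      then have "\<Union>d \<in> d" using Union_in_chain psubset.hyps chain by (metis d_def finite_Diff)
      then show ?thesis by (auto simp: d_def)
    qed
    moreover have sub: "\<Union>d \<subseteq> \<Union>c" by (auto simp: d_def)
    ultimately have "\<Union>c - \<Union>d \<noteq> {}" by blast
    moreover have "sorted_wrt disjnt (Ts @ [\<Union>c - \<Union>d])"
      using Ts(2) Un by (auto simp: sorted_wrt_append disjnt_def)
    moreover have "chain_of_list (Ts @ [\<Union>c - \<Union>d]) = c"
      unfolding chain_of_list_snoc Un Ts(3) using sub top by (auto simp: d_def Un_absorb1)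
    ultimately show ?thesis using Ts(1) by (intro exI[of _ "Ts @ [\<Union>c - \<Union>d]"]) auto
  qed
qed

text \<open>For lists of nonempty disjoint blocks, each further condition on a face translates into
  one on the chain. Successive differences supply a list for every chain.\<close>

lemma coloring_complex_eq:
  assumes "simple_graph E"
  shows "coloring_complex E = edge_chains E"
proof -
  have ne: "e \<noteq> {}" if "e \<in> E" for e using assms that by (auto simp: simple_graph_def)
  have mem_iff: "Ts \<in> coloring_lists E \<longleftrightarrow> chain_of_list Ts \<in> edge_chains E"
    if Ts: "\<forall>T\<in>set Ts. T \<noteq> {}" "sorted_wrt disjnt Ts" for Ts
  proof -
    \<comment> \<open>The union of all blocks is the largest member of the chain, so it is the only
      candidate for \<open>UNIV\<close>.\<close>
    have "\<Union>(set Ts) \<noteq> UNIV \<longleftrightarrow> UNIV \<notin> chain_of_list Ts" if "Ts \<noteq> []"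
      using Union_chain_of_list[of Ts] Union_set_in_chain_of_list[OF that] by auto
    moreover have "(\<exists>e\<in>E. \<exists>T\<in>set (Ts @ [- \<Union>(set Ts)]). e \<subseteq> T) \<longleftrightarrow>
        (\<exists>e\<in>E. \<forall>S\<in>chain_of_list Ts. e \<subseteq> S \<or> e \<inter> S = {})"
      by (intro bex_cong refl
          unseparated_by_chain_of_list_iff[OF Ts(2) ne, symmetric])
    ultimately show ?thesis
      using Ts empty_notin_chain_of_list[OF Ts(1)] subset_chain_chain_of_list[of Ts]
      unfolding coloring_lists_def edge_chains_def proper_chains_def mem_Collect_eq
        chain_of_list_empty_iff by metis
  qed
  show ?thesis
  proof
    show "coloring_complex E \<subseteq> edge_chains E"
    proof
      fix c assume "c \<in> coloring_complex E"
      then obtain Ts where "Ts \<in> coloring_lists E" "c = chain_of_list Ts"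
        by (auto simp: coloring_complex_def)
      then show "c \<in> edge_chains E"
        using mem_iff[of Ts] by (simp add: coloring_lists_def)
    qed
    show "edge_chains E \<subseteq> coloring_complex E"
    proof
      fix c assume c: "c \<in> edge_chains E"
      then have "finite c" "subset.chain UNIV c" "{} \<notin> c"
        by (auto simp: edge_chains_def proper_chains_def)
      from ex_list_with_chain[OF this] show "c \<in> coloring_complex E"
        using mem_iff c by (auto simp: coloring_complex_def)
    qed
  qed
qed

theorem theorem2p1:
  fixes E :: "'n::finite set set"
  assumes "simple_graph E"
  shows "simplicial_cells (restricted_cells E) \<and>
         simplicial_isomorphic (coloring_complex E) (vertex_scheme (restricted_cells E))"
proof
  show "simplicial_cells (restricted_cells E)"
    by (rule simplicial_cells_restricted_cells[OF assms])
  \<comment> \<open>With both complexes expressed by the same chains, \<open>vertex_point\<close>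
    itself is the isomorphism.\<close>
  have "bij_betw vertex_point (\<Union>(edge_chains E)) (\<Union>((`) vertex_point ` edge_chains E))"
    using inj_on_vertex_point by (auto simp: bij_betw_def)
  then show "simplicial_isomorphic (coloring_complex E) (vertex_scheme (restricted_cells E))"
    unfolding simplicial_isomorphic_def coloring_complex_eq[OF assms]
      vertex_scheme_restricted_cells[OF assms] by blast
qed

end
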